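(* The squeezing function $s_{B^n\setminus \{0\}}$ of the $n$-dimensional punctured ball $B^n\setminus \{0\}$ is given by $$s_{B^n\setminus \{0\}}(z)=\| z\|,\qquad z\in B^n\setminus\{0\},$$ where $\| z\|$ is the Euclidean norm of $z$.
   Context: $B^n$ is the open unit ball in $\mathbb{C}^n$ and $B^n(0,r)$ is the open ball with center $0$ and radius $r$. For a bounded domain $D\subset\mathbb{C}^n$ and $p\in D$, the squeezing function is $s_D(p)=\sup_f\,\sup\{r : B^n(0,r)\subset f(D)\}$, where the outer supremum is over all (open) injective holomorphic maps $f: D\rightarrow B^n$ with $f(p)=0$. *)

theory Defs
  imports "HOL-Analysis.Analysis"
begin

text \<open>
  The space of complex n-tuples is the type \<^typ>\<open>complex ^ 'n\<close>, whose \<^const>\<open>norm\<close> is the Euclidean norm.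
  Holomorphy is complex differentiability: the real Frechet derivative exists and is complex-linear.
  As for the one-variable \<open>holomorphic_on\<close>, the derivative is taken within \<open>D\<close>;
  on an open \<open>D\<close> this is the usual derivative.
\<close>

definition holomorphic_map_on :: "(complex ^ 'n \<Rightarrow> complex ^ 'm) \<Rightarrow> (complex ^ 'n) set \<Rightarrow> bool"
  where "holomorphic_map_on f D \<longleftrightarrow>
    (\<forall>z\<in>D. \<exists>f'. (f has_derivative f') (at z within D) \<and> (\<forall>c v. f' (c *s v) = c *s f' v))"

definition squeezing_maps :: "(complex ^ 'n) set \<Rightarrow> complex ^ 'n \<Rightarrow> (complex ^ 'n \<Rightarrow> complex ^ 'n) set"
  where "squeezing_maps D p =
    {f. holomorphic_map_on f D \<and> inj_on f D \<and> (\<forall>U. open U \<and> U \<subseteq> D \<longrightarrow> open (f ` U)) \<and>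
        f ` D \<subseteq> ball 0 1 \<and> f p = 0}"

text \<open>
  For a bounded domain \<open>D\<close> and \<open>p \<in> D\<close> both suprema below range over nonempty sets of reals
  that are bounded above by 1, so the real-valued \<^const>\<open>Sup\<close> is the genuine supremum.
\<close>

definition squeezing_function :: "(complex ^ 'n) set \<Rightarrow> complex ^ 'n \<Rightarrow> real"
  where "squeezing_function D p =
    (SUP f\<in>squeezing_maps D p. Sup {r. 0 < r \<and> ball 0 r \<subseteq> f ` D})"

end

theory Submission
  imports Defs "HOL-Complex_Analysis.Riemann_Mapping"
begin

text \<open>
  Lower bound: the automorphism of the ball that exchanges \<open>z\<close> and \<open>0\<close> maps the punctured ball onto
  the ball without \<open>z\<close>, which contains the ball of radius \<open>norm z\<close>.

  Upper bound: restrict a competitor \<open>f\<close> to the complex line through \<open>0\<close> and \<open>z\<close>. The singularity at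
  \<open>0\<close> is removable, and the limit \<open>w\<close> of \<open>f\<close> there is not a value of \<open>f\<close>: if \<open>w = f b\<close>, then the image
  of a small neighbourhood of \<open>b\<close> is a neighbourhood of \<open>w\<close>, so it contains values of \<open>f\<close> taken near \<open>0\<close>,
  contradicting injectivity. Hence a ball inside the image has radius at most \<open>norm w\<close>, and the
  Schwarz lemma on the line gives \<open>norm w \<le> norm z\<close> because \<open>f z = 0\<close>.
\<close>

section \<open>The Hermitian product\<close>

definition hprod :: "complex ^ 'n \<Rightarrow> complex ^ 'n \<Rightarrow> complex"
  where "hprod x y = (\<Sum>i\<in>UNIV. x $ i * cnj (y $ i))"

lemma hprod_add_left: "hprod (x + y) z = hprod x z + hprod y z"
  by (simp add: hprod_def algebra_simps sum.distrib)

lemma hprod_diff_left: "hprod (x - y) z = hprod x z - hprod y z"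
  by (simp add: hprod_def algebra_simps sum_subtractf)

lemma hprod_scale_left: "hprod (c *s x) y = c * hprod x y"
  by (simp add: hprod_def sum_distrib_left mult.assoc)

lemma hprod_commute: "hprod y x = cnj (hprod x y)"
  by (simp add: hprod_def mult.commute)

lemma hprod_diff_right: "hprod x (y - z) = hprod x y - hprod x z"
  by (metis complex_cnj_diff hprod_commute hprod_diff_left)

lemma hprod_scale_right: "hprod x (c *s y) = cnj c * hprod x y"
  by (metis complex_cnj_mult hprod_commute hprod_scale_left)

lemma hprod_self: "hprod x x = of_real ((norm x)\<^sup>2)"
  by (simp add: hprod_def norm_vec_def L2_set_def sum_nonneg flip: complex_norm_square)

lemma norm_hprod_le: "norm (hprod x y) \<le> norm x * norm y"
proof -
  have "norm (hprod x y) \<le> (\<Sum>i\<in>UNIV. \<bar>norm (x $ i)\<bar> * \<bar>norm (y $ i)\<bar>)"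
    unfolding hprod_def by (rule order_trans[OF norm_sum]) (simp add: norm_mult)
  also have "\<dots> \<le> norm x * norm y"
    unfolding norm_vec_def by (rule L2_set_mult_ineq)
  finally show ?thesis .
qed

text \<open>Cauchy-Schwarz. Strictness in one factor alone lets the other be any vector of norm at
  most 1, which later covers the vector \<open>v\<close> paired with the values of
  \<open>f\<close>.\<close>

lemma norm_hprod_less_1:
  assumes "norm x < 1" "norm y \<le> 1"
  shows "norm (hprod x y) < 1"
proof -
  have "norm x * norm y \<le> norm x * 1"
    using assms by (intro mult_left_mono) auto
  then show ?thesis
    using norm_hprod_le[of x y] assms by linarith
qed

lemma bounded_linear_hprod_left: "bounded_linear (\<lambda>x. hprod x y)"
proof (rule bounded_linear_intro[where K = "norm y"])
  show "hprod (r *\<^sub>R x) y = r *\<^sub>R hprod x y" for r x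
    by (simp add: hprod_def scaleR_sum_right)
qed (auto simp: hprod_add_left norm_hprod_le)

lemma norm_vector_scalar_mult: "norm (c *s x) = norm c * norm x" for x :: "complex ^ 'n"
  by (simp add: norm_vec_def norm_mult L2_set_right_distrib)

text \<open>Makes the product rule available for \<open>*s\<close>, whose scalars are
  complex.\<close>

lemma bounded_bilinear_vector_scalar_mult:
  "bounded_bilinear (\<lambda>(c :: complex) (x :: complex ^ 'n). c *s x)"
proof
  show "\<exists>K. \<forall>c x. norm (c *s (x :: complex ^ 'n)) \<le> norm c * norm x * K"
    by (rule exI[of _ 1]) (simp add: norm_vector_scalar_mult)
qed (auto simp: vec_eq_iff algebra_simps)

section \<open>The involution of the ball exchanging the origin and a given point\<close>

text \<open>
  This is Rudin's \<open>(a - P w - s Q w) / (1 - c)\<close>, where \<open>P\<close> projects onto the line through \<open>a\<close> and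
  \<open>Q = 1 - P\<close>; the identity \<open>(1 - s) P w = (c / (1 + s)) a\<close> removes the division by \<open>norm a\<close>,
  so that \<open>a = 0\<close> needs no separate case.
\<close>

definition ball_involution :: "complex ^ 'n \<Rightarrow> complex ^ 'n \<Rightarrow> complex ^ 'n"
  where "ball_involution a w =
    (let s = complex_of_real (sqrt (1 - (norm a)\<^sup>2)); c = hprod w a
     in inverse (1 - c) *s ((1 - c / (1 + s)) *s a - s *s w))"

lemma ball_involution_0 [simp]: "ball_involution a 0 = a"
  by (simp add: ball_involution_def hprod_def)

context
  fixes a :: "complex ^ 'n" and s :: complex
  assumes a: "norm a < 1"
  defines "s \<equiv> complex_of_real (sqrt (1 - (norm a)\<^sup>2))"
begin

section \<open>Algebra of the involution\<close>

lemma norm_a_sq: "(norm a)\<^sup>2 < 1"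
  using a by (simp add: power_less_one_iff abs_square_less_1)

lemma s_square: "of_real ((norm a)\<^sup>2) = 1 - s\<^sup>2"
  using norm_a_sq by (simp add: s_def flip: of_real_power)

lemma s_nonzero: "s \<noteq> 0" "1 + s \<noteq> 0"
proof -
  have *: "sqrt (1 - (norm a)\<^sup>2) > 0"
    using norm_a_sq by simp
  then show "s \<noteq> 0" by (simp add: s_def)
  have "1 + s = of_real (1 + sqrt (1 - (norm a)\<^sup>2))"
    by (simp add: s_def)
  then show "1 + s \<noteq> 0"
    using * by (metis add_pos_pos of_real_eq_0_iff order_less_irrefl zero_less_one)
qed

lemma one_minus_hprod_nonzero:
  assumes "norm w < 1"
  shows "1 - hprod w a \<noteq> 0"
  using norm_hprod_less_1[OF assms, of a] a by auto

lemma ball_involution_eq: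
  "ball_involution a w = inverse (1 - hprod w a) *s ((1 - hprod w a / (1 + s)) *s a - s *s w)"
  by (simp add: ball_involution_def s_def Let_def)

text \<open>Rests on the classical identity that 1 minus the squared norm of the image equals
  \<open>(1 - (norm a)^2) * (1 - (norm w)^2)\<close> divided by \<open>(norm (1 - c))^2\<close>,
  where \<open>c = hprod w a\<close>.\<close>

lemma norm_ball_involution_less_1:
  assumes w: "norm w < 1"
  shows "norm (ball_involution a w) < 1"
proof -
  define c where "c = hprod w a"
  define t where "t = 1 - c / (1 + s)"
  define W where "W = complex_of_real ((norm w)\<^sup>2)"
  have c1: "1 - c \<noteq> 0"
    using one_minus_hprod_nonzero[OF w] by (simp add: c_def)
  have cs: "cnj s = s" by (simp add: s_def)
  have aw: "hprod a w = cnj c" by (simp add: c_def flip: hprod_commute)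
  have "hprod (t *s a - s *s w) (t *s a - s *s w)
      = t * cnj t * hprod a a - s * t * hprod a w - s * cnj t * hprod w a + s\<^sup>2 * hprod w w"
    by (simp add: hprod_diff_left hprod_diff_right hprod_scale_left hprod_scale_right
        cs power2_eq_square algebra_simps)
  also have "\<dots> = t * cnj t * (1 - s\<^sup>2) - s * t * cnj c - s * cnj t * c + s\<^sup>2 * W"
    by (simp only: hprod_self s_square aw W_def flip: c_def)
  also have "\<dots> = (1 - c) * cnj (1 - c) - s\<^sup>2 * (1 - W)"
  proof -
    have t: "t * (1 + s) = 1 + s - c"
      using s_nonzero by (simp add: t_def field_simps)
    have t': "cnj t * (1 + s) = 1 + s - cnj c"
      using arg_cong[OF t, of cnj] by (simp add: cs)
    \<comment> \<open>One factor \<open>1 + s\<close> clears every denominator: for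
      \<open>t * cnj t\<close> the second one comes from
      \<open>1 - s^2 = (1 - s) * (1 + s)\<close>.\<close>
    have "(t * cnj t * (1 - s\<^sup>2) - s * t * cnj c - s * cnj t * c + s\<^sup>2 * W
        - ((1 - c) * (1 - cnj c) - s\<^sup>2 * (1 - W))) * (1 + s) = 0"
    proof -
      have "(t * cnj t * (1 - s\<^sup>2) - s * t * cnj c - s * cnj t * c + s\<^sup>2 * W
          - ((1 - c) * (1 - cnj c) - s\<^sup>2 * (1 - W))) * (1 + s)
          = (t * (1 + s)) * (cnj t * (1 + s)) * (1 - s) - s * cnj c * (t * (1 + s))
            - s * c * (cnj t * (1 + s)) - ((1 - c) * (1 - cnj c) - s\<^sup>2) * (1 + s)"
        by (simp add: algebra_simps power2_eq_square)
      also have "\<dots> = 0"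
        unfolding t t' by (simp add: algebra_simps power2_eq_square)
      finally show ?thesis .
    qed
    then show ?thesis
      using s_nonzero(2) by simp
  qed
  also have "\<dots> = of_real ((norm (1 - c))\<^sup>2 - (1 - (norm a)\<^sup>2) * (1 - (norm w)\<^sup>2))"
  proof -
    have "s\<^sup>2 = of_real (1 - (norm a)\<^sup>2)"
      by (simp only: of_real_diff of_real_1 s_square) simp
    then show ?thesis
      by (simp only: W_def of_real_diff of_real_mult of_real_1 complex_norm_square[of "1 - c"])
  qed
  finally have "(norm (t *s a - s *s w))\<^sup>2 = (norm (1 - c))\<^sup>2 - (1 - (norm a)\<^sup>2) * (1 - (norm w)\<^sup>2)"
    by (simp only: hprod_self of_real_eq_iff)
  moreover have "(1 - (norm a)\<^sup>2) * (1 - (norm w)\<^sup>2) > 0"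
    using norm_a_sq w by (simp add: abs_square_less_1)
  ultimately have "(norm (t *s a - s *s w))\<^sup>2 < (norm (1 - c))\<^sup>2"
    by (metis diff_gt_0_iff_gt diff_diff_eq2 add_diff_cancel_left')
  then have "norm (t *s a - s *s w) < norm (1 - c)"
    by (rule power2_less_imp_less) simp
  then have "inverse (norm (1 - c)) * norm (t *s a - s *s w) < 1"
    using c1 by (simp add: field_simps)
  then show ?thesis
    by (simp only: ball_involution_eq norm_vector_scalar_mult norm_inverse flip: c_def t_def)
qed

text \<open>In the second application the denominator \<open>1 - d\<close> equals
  \<open>s^2 / (1 - c)\<close>. In its numerator the multiples of \<open>a\<close> cancel, and
  \<open>w\<close> is left with this same factor.\<close>

lemma ball_involution_involutive:
  assumes w: "norm w < 1"
  shows "ball_involution a (ball_involution a w) = w"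
proof -
  define c where "c = hprod w a"
  define d where "d = hprod (ball_involution a w) a"
  have c1: "1 - c \<noteq> 0"
    using one_minus_hprod_nonzero[OF w] by (simp add: c_def)
  have d: "d = (1 - s\<^sup>2 - c) / (1 - c)"
    using s_nonzero c1
    by (simp add: d_def ball_involution_eq hprod_diff_left hprod_scale_left hprod_self
        s_square[simplified] divide_simps flip: c_def)
      (simp add: algebra_simps power2_eq_square)
  have d1: "1 - d = s\<^sup>2 / (1 - c)"
    using c1 by (simp add: d field_simps)
  have *: "(1 - d / (1 + s)) - s * (inverse (1 - c) * (1 - c / (1 + s))) = 0"
    using s_nonzero c1 by (simp add: d divide_simps) (simp add: algebra_simps power2_eq_square)
  have "(1 - d / (1 + s)) *s a - s *s ball_involution a w
      = ((1 - d / (1 + s)) - s * (inverse (1 - c) * (1 - c / (1 + s)))) *s a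
        + (s\<^sup>2 / (1 - c)) *s w"
    by (simp add: ball_involution_eq vec_eq_iff algebra_simps divide_inverse power2_eq_square
        flip: c_def)
  also have "\<dots> = (s\<^sup>2 / (1 - c)) *s w"
    by (simp only: *) (simp add: vec_eq_iff)
  finally have "ball_involution a (ball_involution a w)
      = inverse (s\<^sup>2 / (1 - c)) *s ((s\<^sup>2 / (1 - c)) *s w)"
    by (simp only: ball_involution_eq[of "ball_involution a w"] d1 flip: d_def)
  then show ?thesis
    using s_nonzero c1 by (simp add: vec_eq_iff)
qed

lemma ball_involution_self: "ball_involution a a = 0"
  using ball_involution_involutive[of 0] by simp

section \<open>Holomorphy, injectivity and openness of the involution\<close>

lemma holomorphic_ball_involution:
  assumes D: "D \<subseteq> ball 0 1"
  shows "holomorphic_map_on (ball_involution a) D"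
  unfolding holomorphic_map_on_def
proof
  fix w assume "w \<in> D"
  then have nz: "1 - hprod w a \<noteq> 0"
    using one_minus_hprod_nonzero[of w] D by auto
  define q where "q = inverse (1 - hprod w a)"
  let ?v = "\<lambda>w. (1 - hprod w a / (1 + s)) *s a - s *s w"
  have dh: "((\<lambda>w. hprod w a) has_derivative (\<lambda>h. hprod h a)) (at w within D)"
    by (rule bounded_linear_imp_has_derivative[OF bounded_linear_hprod_left])
  have dq: "((\<lambda>w. inverse (1 - hprod w a)) has_derivative (\<lambda>h. q * hprod h a * q)) (at w within D)"
    using nz by (auto intro!: derivative_eq_intros dh simp: q_def)
  have dc: "((\<lambda>w. 1 - hprod w a / (1 + s)) has_derivative (\<lambda>h. - (hprod h a / (1 + s)))) (at w within D)"
    using s_nonzero by (auto intro!: derivative_eq_intros dh)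
  have dv: "(?v has_derivative (\<lambda>h. (- (hprod h a / (1 + s))) *s a - s *s h)) (at w within D)"
    by (intro has_derivative_diff
        bounded_linear.has_derivative[OF bounded_bilinear.bounded_linear_left
          [OF bounded_bilinear_vector_scalar_mult] dc]
        bounded_linear_imp_has_derivative bounded_bilinear.bounded_linear_right
        bounded_bilinear_vector_scalar_mult)
  have eq: "ball_involution a = (\<lambda>w. inverse (1 - hprod w a) *s ?v w)"
    by (rule ext) (rule ball_involution_eq)
  have "(ball_involution a has_derivative
      (\<lambda>h. q *s ((- (hprod h a / (1 + s))) *s a - s *s h) + (q * hprod h a * q) *s ?v w)) (at w within D)"
    using bounded_bilinear.FDERIV[OF bounded_bilinear_vector_scalar_mult dq dv]
    by (simp only: q_def eq)
  moreover have "\<forall>k h. q *s ((- (hprod (k *s h) a / (1 + s))) *s a - s *s (k *s h))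
        + (q * hprod (k *s h) a * q) *s ?v w
      = k *s (q *s ((- (hprod h a / (1 + s))) *s a - s *s h) + (q * hprod h a * q) *s ?v w)"
    by (simp add: hprod_scale_left vec_eq_iff algebra_simps)
  ultimately show "\<exists>f'. (ball_involution a has_derivative f') (at w within D)
      \<and> (\<forall>k h. f' (k *s h) = k *s f' h)"
    by (intro exI[where x = "\<lambda>h. q *s ((- (hprod h a / (1 + s))) *s a - s *s h)
        + (q * hprod h a * q) *s ?v w"]) (rule conjI)
qed

lemma inj_on_ball_involution: "inj_on (ball_involution a) (ball 0 1)"
  by (rule inj_on_inverseI[where g = "ball_involution a"]) (simp add: ball_involution_involutive)

text \<open>A map that is its own inverse has preimages as images, so openness of images follows
  from mere continuity.\<close>

lemma image_ball_involution:
  assumes "U \<subseteq> ball 0 1"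
  shows "ball_involution a ` U = ball 0 1 \<inter> ball_involution a -` U"
proof (intro equalityI subsetI)
  fix x assume "x \<in> ball_involution a ` U"
  then show "x \<in> ball 0 1 \<inter> ball_involution a -` U"
    using assms ball_involution_involutive norm_ball_involution_less_1 by fastforce
next
  fix x assume x: "x \<in> ball 0 1 \<inter> ball_involution a -` U"
  then have "x = ball_involution a (ball_involution a x)"
    by (simp add: ball_involution_involutive)
  then show "x \<in> ball_involution a ` U"
    using x by blast
qed

lemma open_image_ball_involution:
  assumes "open U" "U \<subseteq> ball 0 1"
  shows "open (ball_involution a ` U)"
proof -
  have "continuous_on (ball 0 1) (ball_involution a)"
    using holomorphic_ball_involution[OF order_refl]
    by (auto simp: holomorphic_map_on_def continuous_on_eq_continuous_within
        intro: has_derivative_continuous)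
  then show ?thesis
    by (simp add: image_ball_involution assms continuous_open_preimage)
qed

lemma ball_involution_in_squeezing_maps:
  assumes "D \<subseteq> ball 0 1"
  shows "ball_involution a \<in> squeezing_maps D a"
  unfolding squeezing_maps_def
  using assms norm_ball_involution_less_1
  by (auto simp: holomorphic_ball_involution ball_involution_self subset_iff
      intro!: open_image_ball_involution inj_on_subset[OF inj_on_ball_involution])

lemma ball_subset_image_ball_involution:
  "ball 0 (norm a) \<subseteq> ball_involution a ` (ball 0 1 - {0})"
proof
  fix x :: "complex ^ 'n" assume x: "x \<in> ball 0 (norm a)"
  then have x1: "norm x < 1"
    using a by simp
  \<comment> \<open>Only \<open>x = a\<close> is sent to 0, and \<open>a\<close> lies on the
    boundary of the ball of radius \<open>norm a\<close>.\<close>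
  have "ball_involution a x \<noteq> 0"
    using ball_involution_involutive[OF x1] x by auto
  then have "ball_involution a x \<in> ball 0 1 - {0}"
    using norm_ball_involution_less_1[OF x1] by simp
  then show "x \<in> ball_involution a ` (ball 0 1 - {0})"
    by (rule rev_image_eqI) (simp add: ball_involution_involutive[OF x1])
qed

end

section \<open>The upper bound\<close>

text \<open>A disc automorphism taking 0 to \<open>p\<close> and \<open>- p\<close> to 0 moves the
  zero of \<open>k\<close> to the origin; the Schwarz lemma is then evaluated at
  \<open>- p\<close>.\<close>

lemma Schwarz_at_zero_of_zero:
  assumes k: "k holomorphic_on ball 0 1" and le: "\<And>x. norm x < 1 \<Longrightarrow> norm (k x) \<le> 1"
    and p: "norm p < 1" "k p = 0"
  shows "norm (k 0) \<le> norm p"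
proof -
  let ?m = "Moebius_function 0 (- p)"
  have mh: "?m holomorphic_on ball 0 1" and mb: "?m ` ball 0 1 \<subseteq> ball 0 1"
    using p by (auto intro!: Moebius_function_holomorphic Moebius_function_norm_lt_1)
  have m0: "?m 0 = p" "?m (- p) = 0"
    by (auto simp: Moebius_function_of_zero Moebius_function_eq_zero)
  \<comment> \<open>The factor \<open>t < 1\<close> turns the weak bound on \<open>k\<close> into
    the strict one of \<open>Schwarz_Lemma\<close>; afterwards \<open>t\<close> tends to 1.\<close>
  have scaled: "t * norm (k 0) \<le> norm p" if t: "0 \<le> t" "t < 1" for t :: real
  proof -
    have "norm (of_real t * k (?m (- p))) \<le> norm (- p)"
    proof (rule Schwarz_Lemma(1)[where f = "\<lambda>x. of_real t * k (?m x)"])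
      have "(k \<circ> ?m) holomorphic_on ball 0 1"
        by (rule holomorphic_on_compose_gen[OF mh k mb])
      then show "(\<lambda>x. of_real t * k (?m x)) holomorphic_on ball 0 1"
        by (auto intro!: holomorphic_intros simp: o_def)
      show "norm (of_real t * k (?m x)) < 1" if "norm x < 1" for x
      proof -
        have "norm (k (?m x)) \<le> 1"
          using that p by (intro le Moebius_function_norm_lt_1) auto
        then have "t * norm (k (?m x)) \<le> t * 1"
          using t by (intro mult_left_mono)
        then show ?thesis
          using t by (simp add: norm_mult)
      qed
    qed (use m0 p in auto)
    then show ?thesis
      using t m0 by (simp add: norm_mult)
  qed
  have "eventually (\<lambda>t :: real. t * norm (k 0) \<le> norm p) (at_left 1)"
    using eventually_at_left_real[OF zero_less_one] by eventually_elim (auto intro: scaled)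
  moreover have "((\<lambda>t :: real. t * norm (k 0)) \<longlongrightarrow> 1 * norm (k 0)) (at_left 1)"
    by (intro tendsto_intros)
  ultimately show ?thesis
    by (simp add: tendsto_upperbound)
qed

text \<open>By the chain rule the derivative is \<open>h\<close> mapped to
  \<open>f' (h *s u) $ i\<close>; complex linearity of \<open>f'\<close> makes this multiplication
  by \<open>f' u $ i\<close>.\<close>

lemma holomorphic_map_on_line:
  assumes "holomorphic_map_on f D" "open D" and S: "open S" "\<And>x. x \<in> S \<Longrightarrow> x *s u \<in> D"
  shows "(\<lambda>x. f (x *s u) $ i) holomorphic_on S"
  unfolding holomorphic_on_open[OF S(1)]
proof
  fix x assume "x \<in> S"
  then obtain f' where f': "(f has_derivative f') (at (x *s u))" "\<And>c v. f' (c *s v) = c *s f' v"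
    using assms unfolding holomorphic_map_on_def by (metis at_within_open)
  have "((\<lambda>x. x *s u) has_derivative (\<lambda>h. h *s u)) (at x)"
    by (intro bounded_linear_imp_has_derivative bounded_bilinear.bounded_linear_left
        bounded_bilinear_vector_scalar_mult)
  from bounded_linear.has_derivative[OF bounded_linear_vec_nth has_derivative_compose[OF this f'(1)]]
  have "((\<lambda>x. f (x *s u) $ i) has_derivative (\<lambda>h. f' u $ i * h)) (at x)"
    by (simp add: f'(2) mult.commute)
  then show "\<exists>d. ((\<lambda>x. f (x *s u) $ i) has_field_derivative d) (at x)"
    by (auto simp: has_field_derivative_def)
qed

lemma radius_le_norm:
  fixes z :: "complex ^ 'n"
  assumes z: "z \<in> ball 0 1 - {0}" and f: "f \<in> squeezing_maps (ball 0 1 - {0}) z"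
    and sub: "ball 0 r \<subseteq> f ` (ball 0 1 - {0})"
  shows "r \<le> norm z"
proof -
  let ?D = "ball 0 1 - {0 :: complex ^ 'n}"
  \<comment> \<open>With a unit vector \<open>u\<close>, the map \<open>x *s u\<close> embeds the
    disc isometrically in the ball and sends \<open>norm z\<close> to \<open>z\<close>.\<close>
  define u where "u = of_real (inverse (norm z)) *s z"
  have nu: "norm u = 1" and zu: "of_real (norm z) *s u = z"
    using z by (simp_all add: u_def norm_vector_scalar_mult norm_inverse vec_eq_iff)
  have f: "holomorphic_map_on f ?D" "inj_on f ?D" "f ` ?D \<subseteq> ball 0 1" "f z = 0"
    and fo: "\<And>U. open U \<Longrightarrow> U \<subseteq> ?D \<Longrightarrow> open (f ` U)"
    using f by (auto simp: squeezing_maps_def)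
  have line: "x *s u \<in> ?D" if "x \<in> ball 0 1 - {0}" for x
  proof -
    have "norm (x *s u) = norm x"
      by (simp add: norm_vector_scalar_mult nu)
    then show ?thesis
      using that by (metis Diff_iff insertCI mem_ball_0 norm_eq_zero singletonD)
  qed
  have fle: "norm (f (x *s u)) < 1" if "x \<in> ball 0 1 - {0}" for x
    using line[OF that] f(3) by (metis image_subset_iff mem_ball_0)
  have ev: "eventually (\<lambda>x :: complex. x \<in> ball 0 1 - {0}) (at 0)"
    by (auto simp: eventually_at intro!: exI[of _ 1])
  \<comment> \<open>Riemann's removable singularity theorem, one coordinate at a time.\<close>
  have "\<exists>H. H holomorphic_on ball 0 1 \<and> (\<forall>x\<in>ball 0 1 - {0}. H x = f (x *s u) $ i)" for i
  proof (subst holomorphic_on_extend_bounded)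
    show "(\<lambda>x. f (x *s u) $ i) holomorphic_on ball 0 1 - {0}"
      by (rule holomorphic_map_on_line[OF f(1)]) (use line in auto)
    show "\<exists>B. eventually (\<lambda>x. norm (f (x *s u) $ i) \<le> B) (at 0)"
      using ev by (intro exI[of _ 1], eventually_elim)
        (meson Finite_Cartesian_Product.norm_nth_le fle less_imp_le order_trans)
  qed auto
  then obtain H where H: "\<And>i. H i holomorphic_on ball 0 1"
      "\<And>i x. x \<in> ball 0 1 - {0} \<Longrightarrow> H i x = f (x *s u) $ i"
    by metis
  define w where "w = (\<chi> i. H i 0)"
  have Hlim: "(H i \<longlongrightarrow> H i 0) (at 0)" for i
    using holomorphic_on_imp_continuous_on[OF H(1)[of i]]
    by (simp add: continuous_on_eq_continuous_at isContD)
  have lim: "((\<lambda>x. f (x *s u)) \<longlongrightarrow> w) (at 0)"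
  proof (rule vec_tendstoI)
    fix i
    show "((\<lambda>x. f (x *s u) $ i) \<longlongrightarrow> w $ i) (at 0)"
      unfolding w_def vec_lambda_beta
      by (rule Lim_transform_eventually[OF Hlim eventually_mono[OF ev]]) (rule H(2))
  qed
  have "w \<notin> f ` ?D"
  proof
    assume "w \<in> f ` ?D"
    then obtain b where b: "b \<in> ?D" "w = f b" by blast
    define U where "U = ball 0 1 - cball (0 :: complex ^ 'n) (norm b / 2)"
    have U: "open U" "b \<in> U" "U \<subseteq> ?D"
      using b by (auto simp: U_def)
    then have "eventually (\<lambda>x. f (x *s u) \<in> f ` U) (at 0)"
      using topological_tendstoD[OF lim fo[OF U(1,3)]] b(2) by auto
    moreover have "eventually (\<lambda>x :: complex. norm x < norm b / 2) (at 0)"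
      using b by (auto simp: eventually_at intro!: exI[of _ "norm b / 2"])
    ultimately have "eventually (\<lambda>x :: complex. False) (at 0)"
      using ev
    proof eventually_elim
      case (elim x)
      then have "x *s u \<in> U"
        using inj_on_image_mem_iff[OF f(2) line[OF elim(3)] U(3)] by blast
      then show False
        using elim(2) by (simp add: U_def norm_vector_scalar_mult nu)
    qed
    then show False by simp
  qed
  then have rw: "r \<le> norm w"
    using sub by (metis mem_ball_0 not_le subsetD)
  \<comment> \<open>Pairing with the direction of \<open>w\<close> yields a scalar function that
    keeps the norm of \<open>w\<close> at 0. If \<open>w = 0\<close>, then \<open>v = 0\<close>
    since \<open>inverse 0 = 0\<close>.\<close>
  define v where "v = of_real (inverse (norm w)) *s w"
  define k where "k = (\<lambda>x. hprod (\<chi> i. H i x) v)"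
  have nv: "norm v \<le> 1"
    by (cases "w = 0") (simp_all add: v_def norm_vector_scalar_mult norm_inverse)
  have k0: "norm (k 0) = norm w"
    by (cases "w = 0") (simp_all add: k_def v_def hprod_scale_right hprod_self norm_mult
        norm_inverse power2_eq_square flip: w_def)
  have kf: "k x = hprod (f (x *s u)) v" if "x \<in> ball 0 1 - {0}" for x
    by (simp add: k_def hprod_def H(2)[OF that])
  have kh: "k holomorphic_on ball 0 1"
    unfolding k_def hprod_def by (auto intro!: holomorphic_intros H)
  have k1: "norm (k x) \<le> 1" if "x \<in> ball 0 1 - {0}" for x
    using norm_hprod_less_1[OF fle[OF that] nv] kf[OF that] by simp
  have "(k \<longlongrightarrow> k 0) (at 0)"
    using holomorphic_on_imp_continuous_on[OF kh]
    by (simp add: continuous_on_eq_continuous_at isContD)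
  \<comment> \<open>At 0 the bound comes from a limit, hence is only weak; this is why
    \<open>Schwarz_at_zero_of_zero\<close> assumes no strict bound.\<close>
  then have "norm (k 0) \<le> 1"
    by (intro Lim_norm_ubound[of "at 0" k]) (use ev in \<open>auto elim!: eventually_mono intro: k1\<close>)
  then have "norm (k x) \<le> 1" if "norm x < 1" for x
    using k1[of x] that by (cases "x = 0") auto
  moreover have "k (of_real (norm z)) = 0"
    using z by (subst kf) (auto simp: zu f(4) hprod_def)
  ultimately have "norm (k 0) \<le> norm (complex_of_real (norm z))"
    using z by (intro Schwarz_at_zero_of_zero kh) auto
  then show ?thesis
    using rw k0 by simp
qed

theorem corollary7p2:
  fixes z :: "complex ^ 'n"
  assumes "z \<in> ball 0 1 - {0}"
  shows "squeezing_function (ball 0 1 - {0}) z = norm z"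
proof -
  let ?D = "ball 0 1 - {0 :: complex ^ 'n}"
  let ?R = "\<lambda>f. {r. 0 < r \<and> ball 0 r \<subseteq> f ` ?D}"
  have z: "norm z < 1" "norm z > 0"
    using assms by auto
  have upper: "Sup (?R f) \<le> norm z" if f: "f \<in> squeezing_maps ?D z" for f
  proof (rule cSup_least)
    \<comment> \<open>\<open>cSup_least\<close> needs an admissible radius: the image of
      \<open>f\<close> is open and contains \<open>f z = 0\<close>.\<close>
    have "open ?D"
      by (intro open_delete open_ball)
    then have "open (f ` ?D)" and "f z = 0"
      using f by (simp_all add: squeezing_maps_def)
    then obtain e where "e > 0" "ball 0 e \<subseteq> f ` ?D"
      using assms by (metis openE imageI)
    then show "?R f \<noteq> {}"
      by blast
  qed (use radius_le_norm[OF assms f] in auto)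
  have inv: "ball_involution z \<in> squeezing_maps ?D z"
    using z by (intro ball_involution_in_squeezing_maps) auto
  \<comment> \<open>The radius \<open>norm z\<close> is itself admissible for the involution;
    \<open>radius_le_norm\<close> supplies the boundedness that \<open>cSup_upper\<close>
    requires.\<close>
  have "norm z \<le> Sup (?R (ball_involution z))"
    using z ball_subset_image_ball_involution[of z] radius_le_norm[OF assms inv]
    by (intro cSup_upper bdd_aboveI[of _ "norm z"]) auto
  then show ?thesis
    unfolding squeezing_function_def using inv
    by (intro antisym cSUP_least cSUP_upper2[of _ _ "ball_involution z"] bdd_aboveI2[of _ _ "norm z"])
      (auto intro: upper)
qed

end
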